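(* Let $a^{(1)},a^{(2)},b^{(1)},b^{(2)}>0$ be constants and let $D_4$ be a diagonal-norm fourth-derivative SBP operator on $m$ grid points with spacing $h>0$, with associated $H,N$ and boundary vectors $e_l,e_r,d_{k;l},d_{k;r}$ ($k=1,2,3$). Let $\alpha_{II},\alpha_{III}>0$ be chosen so that $$\tilde N=N-h\,\alpha_{II}\left(d_{2;l}d_{2;l}^\top+d_{2;r}d_{2;r}^\top\right)-h^3\alpha_{III}\left(d_{3;l}d_{3;l}^\top+d_{3;r}d_{3;r}^\top\right)$$ is positive semi-definite, and let $$\tau=\frac{1}{4\alpha_{III}}(a^{(1)}+a^{(2)}),\qquad \sigma=\frac{1}{4\alpha_{II}}(a^{(1)}+a^{(2)}).$$ Then the semi-discrete system for $w=\begin{bmatrix} v^{(1)} \\ v^{(2)} \end{bmatrix}\in\mathbb{R}^{2m}$, $$(B\otimes I_m)w_{tt}=-(A\otimes D_4)w+SAT_1+SAT_2+SAT_3+SAT_4,$$ with $A=\mathrm{diag}(a^{(1)},a^{(2)})$, $B=\mathrm{diag}(b^{(1)},b^{(2)})$ and $$SAT_1=\begin{bmatrix}-H^{-1}(\frac{\tau}{h^3}e_r+\frac{a^{(1)}}{2}d_{3;r})e_r^\top & H^{-1}(\frac{\tau}{h^3}e_r+\frac{a^{(1)}}{2}d_{3;r})e_l^\top\\ H^{-1}(\frac{\tau}{h^3}e_l+\frac{a^{(2)}}{2}d_{3;l})e_r^\top & -H^{-1}(\frac{\tau}{h^3}e_l+\frac{a^{(2)}}{2}d_{3;l})e_l^\top\end{bmatrix}w,$$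 $$SAT_2=\begin{bmatrix}-H^{-1}(\frac{\sigma}{h}d_{1;r}-\frac{a^{(1)}}{2}d_{2;r})d_{1;r}^\top & -H^{-1}(\frac{\sigma}{h}d_{1;r}-\frac{a^{(1)}}{2}d_{2;r})d_{1;l}^\top\\ -H^{-1}(\frac{\sigma}{h}d_{1;l}+\frac{a^{(2)}}{2}d_{2;l})d_{1;r}^\top & -H^{-1}(\frac{\sigma}{h}d_{1;l}+\frac{a^{(2)}}{2}d_{2;l})d_{1;l}^\top\end{bmatrix}w,$$ $$SAT_3=\begin{bmatrix}-\frac{a^{(1)}}{2}H^{-1}d_{1;r}d_{2;r}^\top & -\frac{a^{(2)}}{2}H^{-1}d_{1;r}d_{2;l}^\top\\ \frac{a^{(1)}}{2}H^{-1}d_{1;l}d_{2;r}^\top & \frac{a^{(2)}}{2}H^{-1}d_{1;l}d_{2;l}^\top\end{bmatrix}w,$$ $$SAT_4=\begin{bmatrix}\frac{a^{(1)}}{2}H^{-1}e_rd_{3;r}^\top & \frac{a^{(2)}}{2}H^{-1}e_rd_{3;l}^\top\\ \frac{a^{(1)}}{2}H^{-1}e_ld_{3;r}^\top & \frac{a^{(2)}}{2}H^{-1}e_ld_{3;l}^\top\end{bmatrix}w,$$ is a stable approximation (up to outer boundary terms) of the dynamic beam equation with piecewise constant parameters.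
   Context: The dynamic beam equation with piecewise constant parameters is $b^{(1)}u^{(1)}_{tt}=-a^{(1)}u^{(1)}_{xxxx}$ on $[x_l,0]$ and $b^{(2)}u^{(2)}_{tt}=-a^{(2)}u^{(2)}_{xxxx}$ on $[0,x_r]$, coupled at $x=0$ by the interface conditions $u^{(1)}=u^{(2)}$, $u^{(1)}_x=u^{(2)}_x$, $a^{(1)}u^{(1)}_{xx}=a^{(2)}u^{(2)}_{xx}$, $a^{(1)}u^{(1)}_{xxx}=a^{(2)}u^{(2)}_{xxx}$. The vectors $v^{(1)}(t),v^{(2)}(t)\in\mathbb{R}^m$ approximate $u^{(1)},u^{(2)}$ on equidistant grids; the same SBP operators are used in both blocks. $\otimes$ is the Kronecker product, $I_m$ the $m\times m$ identity. $e_l=(1,0,\dots,0)^\top$, $e_r=(0,\dots,0,1)^\top$. Diagonal-norm fourth-derivative SBP operator: a matrix $$D_4=H^{-1}\left(N+e_l d_{3;l}^\top+d_{1;l}d_{2;l}^\top+e_r d_{3;r}^\top-d_{1;r}d_{2;r}^\top\right)$$ approximating $\partial^4/\partial x^4$ (with a $2p$th-order accurate narrow stencil in the interior), where $H=H^\top>0$ is diagonal, $N=N^\top\ge 0$ (positive semi-definite), and, for a grid vector $v$ approximating $u$, $d_{1;l}^\top v\approx -u_x$, $d_{2;l}^\top v\approx -u_{xx}$, $d_{3;l}^\top v\approx -u_{xxx}$ at the left end point of the block and $d_{1;r}^\top v\approx u_x$, $d_{2;r}^\top v\approx u_{xx}$, $d_{3;r}^\top v\approx u_{xxx}$ at the right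 end point. Outer boundary conditions are assumed to be handled separately, so terms from the outer boundaries (left end of block 1, right end of block 2) are disregarded. Precisely, write $\|v\|_H^2=v^\top Hv$ and $$BT=-2a^{(1)}\left(e_l^\top v^{(1)}_t\,d_{3;l}^\top v^{(1)}+d_{1;l}^\top v^{(1)}_t\,d_{2;l}^\top v^{(1)}\right)-2a^{(2)}\left(e_r^\top v^{(2)}_t\,d_{3;r}^\top v^{(2)}-d_{1;r}^\top v^{(2)}_t\,d_{2;r}^\top v^{(2)}\right)$$ for the outer boundary terms. Stable (in the energy sense, with zero data, up to outer boundary terms) means: there is a time-independent symmetric positive semi-definite matrix $M\in\mathbb{R}^{2m\times 2m}$ such that for every twice continuously differentiable solution $w(t)$ of the system, the energy $E=b^{(1)}\|v^{(1)}_t\|_H^2+b^{(2)}\|v^{(2)}_t\|_H^2+w^\top Mw$ satisfies $\frac{d}{dt}E\le BT$. *)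

theory Defs
  imports "HOL-Analysis.Analysis" "HOL-Computational_Algebra.Polynomial"
begin

section \<open>Matrices\<close>

definition outer :: "real^'n \<Rightarrow> real^'m \<Rightarrow> real^'m^'n" where
  "outer u v = (\<chi> i j. u $ i * v $ j)"

definition kron :: "real^'n^'k \<Rightarrow> real^'q^'p \<Rightarrow> real^('n \<times> 'q)^('k \<times> 'p)" where
  "kron A D = (\<chi> i j. A $ fst i $ fst j * D $ snd i $ snd j)"

definition diag2 :: "real \<Rightarrow> real \<Rightarrow> real^2^2" where
  "diag2 x y = vector [vector [x, 0], vector [0, y]]"

definition blocks2 ::
  "real^'m^'m \<Rightarrow> real^'m^'m \<Rightarrow> real^'m^'m \<Rightarrow> real^'m^'m \<Rightarrow> real^(2 \<times> 'm)^(2 \<times> 'm)" where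
  "blocks2 P Q R S =
     (\<chi> i j. (if fst i = 1 then (if fst j = 1 then P else Q)
              else (if fst j = 1 then R else S)) $ snd i $ snd j)"

definition block :: "2 \<Rightarrow> real^(2 \<times> 'm) \<Rightarrow> real^'m" where
  "block b w = (\<chi> i. w $ (b, i))"

definition diagonal :: "real^'m^'m \<Rightarrow> bool" where
  "diagonal A \<longleftrightarrow> (\<forall>i j. i \<noteq> j \<longrightarrow> A $ i $ j = 0)"

definition pos_semidef :: "real^'m^'m \<Rightarrow> bool" where
  "pos_semidef A \<longleftrightarrow> transpose A = A \<and> (\<forall>x. 0 \<le> x \<bullet> (A *v x))"

definition pos_def :: "real^'m^'m \<Rightarrow> bool" where
  "pos_def A \<longleftrightarrow> transpose A = A \<and> (\<forall>x. x \<noteq> 0 \<longrightarrow> 0 < x \<bullet> (A *v x))"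

text \<open>The syntax \<open>real^'m\<close> forces the sort \<open>finite\<close> on \<open>'m\<close> and so clashes with an annotation
  \<open>{finite,linorder}\<close> elsewhere in the same signature; these synonyms avoid that.\<close>

type_synonym 'm vec1 = "(real, 'm) vec"
type_synonym 'm mat1 = "((real, 'm) vec, 'm) vec"
type_synonym 'm vec2 = "(real, 2 \<times> 'm) vec"
type_synonym 'm mat2 = "((real, 2 \<times> 'm) vec, 2 \<times> 'm) vec"

section \<open>Grid\<close>

text \<open>The grid points of one block are the elements of a finite linearly ordered type with
  \<open>m = CARD('m)\<close> elements, listed from left to right.  The conditions below that refer to
  positions are translation invariant, so the left end point is put at the origin.\<close>

definition grid_index :: "'m::{finite,linorder} \<Rightarrow> nat" where
  "grid_index i = card {j. j < i}"

definition grid_point :: "real \<Rightarrow> 'm::{finite,linorder} \<Rightarrow> real" where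
  "grid_point h i = h * real (grid_index i)"

definition grid_fun :: "real \<Rightarrow> (real \<Rightarrow> real) \<Rightarrow> ('m::{finite,linorder}) vec1" where
  "grid_fun h u = (\<chi> i. u (grid_point h i))"

definition left_pt :: "'m::{finite,linorder}" where "left_pt = Min UNIV"
definition right_pt :: "'m::{finite,linorder}" where "right_pt = Max UNIV"

definition e_l :: "('m::{finite,linorder}) vec1" where "e_l = axis left_pt 1"
definition e_r :: "('m::{finite,linorder}) vec1" where "e_r = axis right_pt 1"

section \<open>Diagonal-norm fourth-derivative SBP operators\<close>

text \<open>Accuracy is expressed as exactness on polynomials.  A central stencil for the fourth
  derivative on the grid is accurate of order \<open>2p\<close> iff it is exact up to degree \<open>2p + 3\<close>; it is narrow if
  it has the minimal half-width \<open>p + 1\<close>.  Here \<open>s\<close> is the number of rows at either end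
  that belong to the boundary closure.\<close>

definition interior_accurate ::
  "nat \<Rightarrow> real \<Rightarrow> ('m::{finite,linorder}) mat1 \<Rightarrow> bool" where
  "interior_accurate p h D \<longleftrightarrow>
     (\<exists>s. p + 1 \<le> s \<and> 2 * s < CARD('m) \<and>
       (\<forall>i. s \<le> grid_index i \<and> grid_index i + s < CARD('m) \<longrightarrow>
          (\<forall>j. grid_index i + (p + 1) < grid_index j \<or> grid_index j + (p + 1) < grid_index i
                \<longrightarrow> D $ i $ j = 0) \<and>
          (\<forall>q :: real poly. degree q \<le> 2 * p + 3 \<longrightarrow>
                (D *v grid_fun h (poly q)) $ i = poly ((pderiv ^^ 4) q) (grid_point h i))))"

text \<open>A difference formula with weights scaling as \<open>h\<close> to the power \<open>-k\<close> is a consistent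
  approximation of \<open>c\<close> times the \<open>k\<close>-th derivative at a grid point iff it is exact on
  polynomials of degree at most \<open>k\<close>.\<close>

definition approx_deriv_at ::
  "real \<Rightarrow> 'm::{finite,linorder} \<Rightarrow> nat \<Rightarrow> real \<Rightarrow> 'm vec1 \<Rightarrow> bool" where
  "approx_deriv_at h i k c d \<longleftrightarrow>
     (\<forall>q :: real poly. degree q \<le> k \<longrightarrow>
        d \<bullet> grid_fun h (poly q) = c * poly ((pderiv ^^ k) q) (grid_point h i))"

definition sbp4 ::
  "nat \<Rightarrow> real \<Rightarrow> 'm mat1 \<Rightarrow> 'm mat1 \<Rightarrow>
   'm vec1 \<Rightarrow> 'm vec1 \<Rightarrow> 'm vec1 \<Rightarrow> 'm vec1 \<Rightarrow> 'm vec1 \<Rightarrow> 'm vec1 \<Rightarrow>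
   ('m::{finite,linorder}) mat1 \<Rightarrow> bool" where
  "sbp4 p h H N d1l d2l d3l d1r d2r d3r D4 \<longleftrightarrow>
     0 < p \<and> 0 < h \<and>
     diagonal H \<and> pos_def H \<and> pos_semidef N \<and>
     D4 = matrix_inv H **
            (N + outer e_l d3l + outer d1l d2l + outer e_r d3r - outer d1r d2r) \<and>
     interior_accurate p h D4 \<and>
     approx_deriv_at h left_pt 1 (-1) d1l \<and>
     approx_deriv_at h left_pt 2 (-1) d2l \<and>
     approx_deriv_at h left_pt 3 (-1) d3l \<and>
     approx_deriv_at h right_pt 1 1 d1r \<and>
     approx_deriv_at h right_pt 2 1 d2r \<and>
     approx_deriv_at h right_pt 3 1 d3r"

section \<open>Interface penalty terms\<close>

definition sat1 ::
  "real \<Rightarrow> real \<Rightarrow> real \<Rightarrow> real \<Rightarrow> 'm mat1 \<Rightarrow> 'm vec1 \<Rightarrow> 'm vec1 \<Rightarrow>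
   ('m::{finite,linorder}) mat2" where
  "sat1 \<tau> h a1 a2 H d3l d3r =
     blocks2
       (- (matrix_inv H ** outer ((\<tau> / h^3) *\<^sub>R e_r + (a1 / 2) *\<^sub>R d3r) e_r))
       (matrix_inv H ** outer ((\<tau> / h^3) *\<^sub>R e_r + (a1 / 2) *\<^sub>R d3r) e_l)
       (matrix_inv H ** outer ((\<tau> / h^3) *\<^sub>R e_l + (a2 / 2) *\<^sub>R d3l) e_r)
       (- (matrix_inv H ** outer ((\<tau> / h^3) *\<^sub>R e_l + (a2 / 2) *\<^sub>R d3l) e_l))"

definition sat2 ::
  "real \<Rightarrow> real \<Rightarrow> real \<Rightarrow> real \<Rightarrow> ('m::finite) mat1 \<Rightarrow>
   'm vec1 \<Rightarrow> 'm vec1 \<Rightarrow> 'm vec1 \<Rightarrow> 'm vec1 \<Rightarrow> 'm mat2" where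
  "sat2 \<sigma> h a1 a2 H d1l d2l d1r d2r =
     blocks2
       (- (matrix_inv H ** outer ((\<sigma> / h) *\<^sub>R d1r - (a1 / 2) *\<^sub>R d2r) d1r))
       (- (matrix_inv H ** outer ((\<sigma> / h) *\<^sub>R d1r - (a1 / 2) *\<^sub>R d2r) d1l))
       (- (matrix_inv H ** outer ((\<sigma> / h) *\<^sub>R d1l + (a2 / 2) *\<^sub>R d2l) d1r))
       (- (matrix_inv H ** outer ((\<sigma> / h) *\<^sub>R d1l + (a2 / 2) *\<^sub>R d2l) d1l))"

definition sat3 ::
  "real \<Rightarrow> real \<Rightarrow> ('m::finite) mat1 \<Rightarrow>
   'm vec1 \<Rightarrow> 'm vec1 \<Rightarrow> 'm vec1 \<Rightarrow> 'm vec1 \<Rightarrow> 'm mat2" where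
  "sat3 a1 a2 H d1l d2l d1r d2r =
     blocks2
       (- (a1 / 2) *\<^sub>R (matrix_inv H ** outer d1r d2r))
       (- (a2 / 2) *\<^sub>R (matrix_inv H ** outer d1r d2l))
       ((a1 / 2) *\<^sub>R (matrix_inv H ** outer d1l d2r))
       ((a2 / 2) *\<^sub>R (matrix_inv H ** outer d1l d2l))"

definition sat4 ::
  "real \<Rightarrow> real \<Rightarrow> 'm mat1 \<Rightarrow> 'm vec1 \<Rightarrow> 'm vec1 \<Rightarrow>
   ('m::{finite,linorder}) mat2" where
  "sat4 a1 a2 H d3l d3r =
     blocks2
       ((a1 / 2) *\<^sub>R (matrix_inv H ** outer e_r d3r))
       ((a2 / 2) *\<^sub>R (matrix_inv H ** outer e_r d3l))
       ((a1 / 2) *\<^sub>R (matrix_inv H ** outer e_l d3r))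
       ((a2 / 2) *\<^sub>R (matrix_inv H ** outer e_l d3l))"

section \<open>Energy stability up to outer boundary terms\<close>

definition norm2_H :: "('m::finite) mat1 \<Rightarrow> 'm vec1 \<Rightarrow> real" where
  "norm2_H H v = v \<bullet> (H *v v)"

definition energy ::
  "real \<Rightarrow> real \<Rightarrow> ('m::finite) mat1 \<Rightarrow> 'm mat2 \<Rightarrow>
   'm vec2 \<Rightarrow> 'm vec2 \<Rightarrow> real" where
  "energy b1 b2 H M w wt =
     b1 * norm2_H H (block 1 wt) + b2 * norm2_H H (block 2 wt) + w \<bullet> (M *v w)"

definition outer_boundary_terms ::
  "real \<Rightarrow> real \<Rightarrow> 'm vec1 \<Rightarrow> 'm vec1 \<Rightarrow> 'm vec1 \<Rightarrow> 'm vec1 \<Rightarrow> 'm vec1 \<Rightarrow> 'm vec1 \<Rightarrow>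
   ('m::{finite,linorder}) vec2 \<Rightarrow> 'm vec2 \<Rightarrow> real" where
  "outer_boundary_terms a1 a2 d1l d2l d3l d1r d2r d3r w wt =
     - 2 * a1 * ((e_l \<bullet> block 1 wt) * (d3l \<bullet> block 1 w)
                 + (d1l \<bullet> block 1 wt) * (d2l \<bullet> block 1 w))
     - 2 * a2 * ((e_r \<bullet> block 2 wt) * (d3r \<bullet> block 2 w)
                 - (d1r \<bullet> block 2 wt) * (d2r \<bullet> block 2 w))"

text \<open>\<open>Sys u z\<close> is the relation the system imposes between the values \<open>u\<close> and \<open>z\<close> of the
  solution and its second time derivative.  Solutions may live on any nondegenerate time
  interval \<open>T\<close>, with one-sided derivatives at end points belonging to \<open>T\<close>.\<close>

definition solution_on ::
  "(real^'k \<Rightarrow> real^'k \<Rightarrow> bool) \<Rightarrow> real set \<Rightarrow>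
   (real \<Rightarrow> real^'k) \<Rightarrow> (real \<Rightarrow> real^'k) \<Rightarrow> (real \<Rightarrow> real^'k) \<Rightarrow> bool" where
  "solution_on Sys T w wt wtt \<longleftrightarrow>
     (\<forall>t\<in>T. (w has_vector_derivative wt t) (at t within T)) \<and>
     (\<forall>t\<in>T. (wt has_vector_derivative wtt t) (at t within T)) \<and>
     continuous_on T wtt \<and>
     (\<forall>t\<in>T. Sys (w t) (wtt t))"

definition stable_up_to_outer_boundary ::
  "real \<Rightarrow> real \<Rightarrow> real \<Rightarrow> real \<Rightarrow> 'm mat1 \<Rightarrow>
   'm vec1 \<Rightarrow> 'm vec1 \<Rightarrow> 'm vec1 \<Rightarrow> 'm vec1 \<Rightarrow> 'm vec1 \<Rightarrow> 'm vec1 \<Rightarrow>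
   (('m::{finite,linorder}) vec2 \<Rightarrow> 'm vec2 \<Rightarrow> bool) \<Rightarrow> bool" where
  "stable_up_to_outer_boundary a1 a2 b1 b2 H d1l d2l d3l d1r d2r d3r Sys \<longleftrightarrow>
     (\<exists>M. pos_semidef M \<and>
       (\<forall>T w wt wtt. is_interval T \<and> interior T \<noteq> {} \<and> solution_on Sys T w wt wtt \<longrightarrow>
          (\<forall>t\<in>T. \<exists>E'.
             ((\<lambda>s. energy b1 b2 H M (w s) (wt s)) has_real_derivative E') (at t within T) \<and>
             E' \<le> outer_boundary_terms a1 a2 d1l d2l d3l d1r d2r d3r (w t) (wt t))))"

end

theory Submission
  imports Defs
begin

text \<open>Energy method.  Multiply the block equations by \<open>2 H v\<^sub>t\<close>.  Writing \<open>J\<close>, \<open>K\<close>, \<open>Q\<close>, \<open>P\<close> for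
  the linear forms measuring the interface jumps of \<open>u\<close>, \<open>u\<^sub>x\<close>, \<open>a u\<^sub>x\<^sub>x\<close>, \<open>a u\<^sub>x\<^sub>x\<^sub>x\<close> (as approximated
  by the scheme), the penalty terms symmetrise the interface contributions, so that all terms
  except the outer boundary terms form the time derivative of minus
  \<open>a1 x1\<cdot>N x1 + a2 x2\<cdot>N x2 + \<tau>/h\<^sup>3 J\<^sup>2 + J P + \<sigma>/h K\<^sup>2 - K Q\<close>.  The borrowing hypothesis bounds
  \<open>x\<cdot>N x\<close> from below by squares of the discrete second and third boundary derivatives, and the
  choice of \<open>\<tau>\<close> and \<open>\<sigma>\<close> completes these squares, so this form is nonnegative.\<close>

section \<open>Block vectors and matrices\<close>

text \<open>Represents a linear form on two-block vectors by its parts on the blocks, so that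
  products of interface forms become matrices via \<open>outer\<close>.\<close>

definition join2 :: "real^'m \<Rightarrow> real^'m \<Rightarrow> real^(2 \<times> 'm)" where
  "join2 u v = (\<chi> i. (if fst i = 1 then u else v) $ snd i)"

lemma sum_UNIV_2_times:
  "(\<Sum>i\<in>(UNIV :: (2 \<times> 'm::finite) set). f i) = (\<Sum>k\<in>UNIV. f (1, k)) + (\<Sum>k\<in>UNIV. f (2, k))"
  using sum.cartesian_product[of "\<lambda>b k. f (b, k)" "UNIV :: 'm set" "UNIV :: 2 set"]
  by (simp add: sum_2)

lemma inner_join2: "join2 u v \<bullet> w = u \<bullet> block 1 w + v \<bullet> block 2 w"
  by (simp add: join2_def block_def inner_vec_def sum_UNIV_2_times)

lemma inner_blocks: "x \<bullet> y = block 1 x \<bullet> block 1 y + block 2 x \<bullet> block 2 y"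
  by (simp add: block_def inner_vec_def sum_UNIV_2_times)

lemma bounded_linear_block: "bounded_linear (block b)"
  unfolding linear_conv_bounded_linear[symmetric]
  by (rule linearI) (simp_all add: block_def vec_eq_iff)

lemmas block_linear_simps =
  linear_add[OF bounded_linear.linear[OF bounded_linear_block]]
  linear_diff[OF bounded_linear.linear[OF bounded_linear_block]]
  linear_neg[OF bounded_linear.linear[OF bounded_linear_block]]

lemma block_blocks2:
  "block 1 (blocks2 P Q R S *v w) = P *v block 1 w + Q *v block 2 w"
  "block 2 (blocks2 P Q R S *v w) = R *v block 1 w + S *v block 2 w"
  by (simp_all add: blocks2_def block_def vec_eq_iff matrix_vector_mult_def sum_UNIV_2_times)

lemma block_kron_diag2:
  "block 1 (kron (diag2 x y) D *v w) = x *\<^sub>R (D *v block 1 w)"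
  "block 2 (kron (diag2 x y) D *v w) = y *\<^sub>R (D *v block 2 w)"
  by (simp_all add: kron_def diag2_def block_def vec_eq_iff matrix_vector_mult_def
      sum_UNIV_2_times sum_distrib_left mult.assoc)

lemma transpose_kron_diag2:
  "transpose (kron (diag2 x y) D) = kron (diag2 x y) (transpose D)"
proof -
  have "diag2 x y $ i $ j = diag2 x y $ j $ i" for i j
    using exhaust_2[of i] exhaust_2[of j] by (auto simp: diag2_def)
  then show ?thesis
    by (simp add: transpose_def kron_def vec_eq_iff)
qed

section \<open>Outer products and quadratic forms\<close>

lemma outer_mult_vec: "outer u v *v x = (v \<bullet> x) *\<^sub>R u"
  by (simp add: outer_def vec_eq_iff matrix_vector_mult_def inner_vec_def
      sum_distrib_right sum_distrib_left mult_ac)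

lemma transpose_outer: "transpose (outer u v) = outer v u"
  by (simp add: outer_def transpose_def vec_eq_iff mult.commute)

lemma transpose_add: "transpose (A + B) = transpose A + transpose (B :: real^'n^'m)"
  by (simp add: transpose_def vec_eq_iff)

lemma transpose_diff: "transpose (A - B) = transpose A - transpose (B :: real^'n^'m)"
  by (simp add: transpose_def vec_eq_iff)

lemma matrix_vector_mult_minus_left: "(- A) *v x = - (A *v (x :: real^'n))"
  using matrix_vector_mult_diff_rdistrib[of 0 A x] by simp

text \<open>Definiteness forces a trivial kernel, hence invertibility. This lets multiplication by
  \<open>H\<close> cancel \<open>matrix_inv H\<close> in \<open>D4\<close> and in every penalty
  term.\<close>

lemma pos_def_mult_matrix_inv:
  assumes "pos_def H"
  shows "H ** matrix_inv H = mat 1"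
proof -
  have "H *v x = 0 \<Longrightarrow> x = 0" for x
    using assms unfolding pos_def_def by (metis inner_zero_right less_irrefl)
  then have "invertible H"
    using matrix_left_invertible_ker[of H] invertible_left_inverse[of H] by blast
  then show ?thesis
    unfolding invertible_def matrix_inv_def by (rule someI2_ex) simp
qed

text \<open>Symmetry of \<open>A\<close> merges the two terms of the product rule. It serves both
  the \<open>H\<close>-norms of the velocities and the part of the energy that depends on
  \<open>w\<close>.\<close>

lemma has_real_derivative_quadratic_form:
  fixes x :: "real \<Rightarrow> real^'n"
  assumes "(x has_vector_derivative x') (at t within T)" and "transpose A = A"
  shows "((\<lambda>s. x s \<bullet> (A *v x s)) has_real_derivative 2 * (x' \<bullet> (A *v x t))) (at t within T)"
proof -
  have "((\<lambda>s. A *v x s) has_vector_derivative A *v x') (at t within T)"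
    by (rule bounded_linear.has_vector_derivative[OF matrix_vector_mul_bounded_linear assms(1)])
  with assms(1) have "((\<lambda>s. x s \<bullet> (A *v x s)) has_vector_derivative
      x t \<bullet> (A *v x') + x' \<bullet> (A *v x t)) (at t within T)"
    by (rule bounded_bilinear.has_vector_derivative[OF bounded_bilinear_inner])
  moreover have "x t \<bullet> (A *v x') = x' \<bullet> (A *v x t)"
    using assms(2) by (metis dot_lmul_matrix inner_commute vector_transpose_matrix)
  ultimately show ?thesis
    by (simp add: has_real_derivative_iff_has_vector_derivative)
qed

section \<open>Energy of the semi-discrete scheme\<close>

text \<open>The matrix \<open>M\<close> of the energy; mixed products are symmetrised with weight
  1/2. Since \<open>d1l\<close>, \<open>d2l\<close>, \<open>d3l\<close> approximate minus the
  derivatives, \<open>J\<close> and \<open>K\<close> are the jumps of u and u_x, while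
  \<open>Q\<close> and \<open>P\<close> add the one-sided values of a u_xx and a u_xxx, so they are
  twice the averages.\<close>

definition interface_matrix ::
  "real \<Rightarrow> real \<Rightarrow> real \<Rightarrow> real \<Rightarrow> real \<Rightarrow> 'm mat1 \<Rightarrow> 'm vec1 \<Rightarrow> 'm vec1 \<Rightarrow> 'm vec1 \<Rightarrow>
   'm vec1 \<Rightarrow> 'm vec1 \<Rightarrow> 'm vec1 \<Rightarrow> ('m::{finite,linorder}) mat2" where
  "interface_matrix \<tau> \<sigma> h a1 a2 N d1l d2l d3l d1r d2r d3r =
     (let J = join2 e_r (- e_l); K = join2 d1r d1l;
          Q = join2 (a1 *\<^sub>R d2r) (- (a2 *\<^sub>R d2l)); P = join2 (a1 *\<^sub>R d3r) (- (a2 *\<^sub>R d3l))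
      in kron (diag2 a1 a2) N
         + ((\<tau> / h^3) *\<^sub>R outer J J + (1/2) *\<^sub>R (outer J P + outer P J))
         + ((\<sigma> / h) *\<^sub>R outer K K - (1/2) *\<^sub>R (outer K Q + outer Q K)))"

text \<open>Two vectors occur because the energy rate pairs the velocity with the solution;
  positivity uses the diagonal case \<open>y = x\<close>.\<close>

lemma inner_interface_matrix:
  fixes x y :: "('m::{finite,linorder}) vec2" and d1l d2l d3l d1r d2r d3r :: "'m vec1"
    and a1 a2 :: real
  defines "J \<equiv> \<lambda>x. e_r \<bullet> block 1 x - e_l \<bullet> block 2 x"
    and "K \<equiv> \<lambda>x. d1r \<bullet> block 1 x + d1l \<bullet> block 2 x"
    and "Q \<equiv> \<lambda>x. a1 * (d2r \<bullet> block 1 x) - a2 * (d2l \<bullet> block 2 x)"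
    and "P \<equiv> \<lambda>x. a1 * (d3r \<bullet> block 1 x) - a2 * (d3l \<bullet> block 2 x)"
  shows "y \<bullet> (interface_matrix \<tau> \<sigma> h a1 a2 N d1l d2l d3l d1r d2r d3r *v x) =
    a1 * (block 1 y \<bullet> (N *v block 1 x)) + a2 * (block 2 y \<bullet> (N *v block 2 x))
    + \<tau> / h^3 * J y * J x + (J y * P x + P y * J x) / 2
    + \<sigma> / h * K y * K x - (K y * Q x + Q y * K x) / 2"
  unfolding interface_matrix_def Let_def matrix_vector_mult_add_rdistrib
    matrix_vector_mult_diff_rdistrib scaleR_matrix_vector_assoc[symmetric] outer_mult_vec
    inner_add_right inner_diff_right inner_scaleR_right
    inner_blocks[of y "kron _ _ *v _"] block_kron_diag2
  unfolding inner_scaleR_left inner_commute[of y] inner_join2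
    inner_minus_left J_def K_def Q_def P_def
  by (simp add: algebra_simps add_divide_distrib diff_divide_distrib)

lemma transpose_interface_matrix:
  assumes "transpose N = N"
  shows "transpose (interface_matrix \<tau> \<sigma> h a1 a2 N d1l d2l d3l d1r d2r d3r) =
    interface_matrix \<tau> \<sigma> h a1 a2 N d1l d2l d3l d1r d2r d3r"
  by (simp add: interface_matrix_def Let_def transpose_add transpose_diff transpose_outer
      transpose_kron_diag2 transpose_scalar assms add_ac)

text \<open>The two squares weighted by \<open>\<alpha>\<close> are what is borrowed from the stiffness matrices of the two
  blocks; the penalty strength \<open>(a1 + a2) / (4 \<alpha>)\<close> splits between them.\<close>

lemma borrowing_nonneg:
  fixes a1 a2 c :: real
  assumes "0 < a1" "0 < a2" "0 < c"
  shows "0 \<le> a1 * (c * p1\<^sup>2) + a2 * (c * p2\<^sup>2) + (a1 + a2) / (4 * c) * j\<^sup>2 + j * (a1 * p1 - a2 * p2)"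
proof -
  \<comment> \<open>Block by block, \<open>c * p^2 + j * p + j^2 / (4 * c)\<close> is a complete
    square; in block 2 the sign of \<open>j\<close> is reversed.\<close>
  have "a1 * (c * p1\<^sup>2) + a2 * (c * p2\<^sup>2) + (a1 + a2) / (4 * c) * j\<^sup>2 + j * (a1 * p1 - a2 * p2)
      = a1 * ((2 * c * p1 + j)\<^sup>2 / (4 * c)) + a2 * ((2 * c * p2 - j)\<^sup>2 / (4 * c))"
    using assms(3) by (simp add: field_simps power2_eq_square)
  also have "\<dots> \<ge> 0"
    using assms by simp
  finally show ?thesis .
qed

lemma pos_semidef_interface_matrix:
  fixes N :: "('m::{finite,linorder}) mat1"
  assumes "0 < a1" "0 < a2" "0 < h" "0 < \<alpha>II" "0 < \<alpha>III" "transpose N = N"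
    and tilde: "pos_semidef (N - (h * \<alpha>II) *\<^sub>R (outer d2l d2l + outer d2r d2r)
                        - (h^3 * \<alpha>III) *\<^sub>R (outer d3l d3l + outer d3r d3r))"
    and \<tau>: "\<tau> = 1 / (4 * \<alpha>III) * (a1 + a2)"
    and \<sigma>: "\<sigma> = 1 / (4 * \<alpha>II) * (a1 + a2)"
  shows "pos_semidef (interface_matrix \<tau> \<sigma> h a1 a2 N d1l d2l d3l d1r d2r d3r)"
proof -
  have N: "h * \<alpha>II * ((d2l \<bullet> x)\<^sup>2 + (d2r \<bullet> x)\<^sup>2) + h^3 * \<alpha>III * ((d3l \<bullet> x)\<^sup>2 + (d3r \<bullet> x)\<^sup>2)
      \<le> x \<bullet> (N *v x)" for x
  proof -
    have "0 \<le> x \<bullet> ((N - (h * \<alpha>II) *\<^sub>R (outer d2l d2l + outer d2r d2r)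
                        - (h^3 * \<alpha>III) *\<^sub>R (outer d3l d3l + outer d3r d3r)) *v x)"
      using tilde by (simp add: pos_semidef_def)
    then show ?thesis
      unfolding matrix_vector_mult_diff_rdistrib scaleR_matrix_vector_assoc[symmetric]
        matrix_vector_mult_add_rdistrib outer_mult_vec
      by (simp add: inner_simps inner_commute[of x] power2_eq_square)
  qed
  have "0 \<le> x \<bullet> (interface_matrix \<tau> \<sigma> h a1 a2 N d1l d2l d3l d1r d2r d3r *v x)" for x
  proof -
    define x1 x2 where "x1 = block 1 x" and "x2 = block 2 x"
    define J where "J = e_r \<bullet> x1 - e_l \<bullet> x2"
    define K where "K = d1r \<bullet> x1 + d1l \<bullet> x2"
    \<comment> \<open>The penalties in the form \<open>borrowing_nonneg\<close> expects, with
      \<open>c = h^3 * \<alpha>III\<close> for the coupling \<open>J P\<close> and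
      \<open>c = h * \<alpha>II\<close> for \<open>- K Q\<close>. The latter's sign is why
      \<open>- K\<close> takes the place of \<open>j\<close>.\<close>
    define TJ TK where "TJ = (a1 + a2) / (4 * (h^3 * \<alpha>III)) * J\<^sup>2"
      and "TK = (a1 + a2) / (4 * (h * \<alpha>II)) * (- K)\<^sup>2"
    have II: "0 < h * \<alpha>II" and III: "0 < h^3 * \<alpha>III"
      using assms by simp_all
    \<comment> \<open>Only the interface end of each block is needed: the right end here, the left
      end for block 2. The nonnegative squares from the outer ends are dropped.\<close>
    have "a1 * (h * \<alpha>II * (d2r \<bullet> x1)\<^sup>2 + h^3 * \<alpha>III * (d3r \<bullet> x1)\<^sup>2) \<le> a1 * (x1 \<bullet> (N *v x1))"
      by (rule mult_left_mono[OF order_trans[OF _ N[of x1]]])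
        (use assms(1) II III in \<open>simp_all add: distrib_left\<close>)
    moreover have "a2 * (h * \<alpha>II * (d2l \<bullet> x2)\<^sup>2 + h^3 * \<alpha>III * (d3l \<bullet> x2)\<^sup>2) \<le> a2 * (x2 \<bullet> (N *v x2))"
      by (rule mult_left_mono[OF order_trans[OF _ N[of x2]]])
        (use assms(2) II III in \<open>simp_all add: distrib_left\<close>)
    moreover have "\<tau> / h^3 * J * J = TJ" "\<sigma> / h * K * K = TK"
      by (simp_all add: TJ_def TK_def \<tau> \<sigma> power2_eq_square mult_ac)
    moreover note
      borrowing_nonneg[OF assms(1,2) III, of "d3r \<bullet> x1" "d3l \<bullet> x2" J, folded TJ_def]
      borrowing_nonneg[OF assms(1,2) II, of "d2r \<bullet> x1" "d2l \<bullet> x2" "- K", folded TK_def]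
    ultimately show ?thesis
      unfolding inner_interface_matrix x1_def[symmetric] x2_def[symmetric]
        J_def[symmetric] K_def[symmetric]
      by (simp add: algebra_simps diff_divide_distrib)
  qed
  then show ?thesis
    using assms(6) by (simp add: pos_semidef_def transpose_interface_matrix)
qed

section \<open>Energy balance along solutions and stability\<close>

theorem lemma5:
  fixes p :: nat
    and h a1 a2 b1 b2 \<alpha>II \<alpha>III \<tau> \<sigma> :: real
    and H N D4 :: "('m::{finite,linorder}) mat1"
    and d1l d2l d3l d1r d2r d3r :: "'m vec1"
  assumes "0 < a1" and "0 < a2" and "0 < b1" and "0 < b2"
    and "0 < h"
    and "sbp4 p h H N d1l d2l d3l d1r d2r d3r D4"
    and "0 < \<alpha>II" and "0 < \<alpha>III"
    and "pos_semidef (N - (h * \<alpha>II) *\<^sub>R (outer d2l d2l + outer d2r d2r)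
                        - (h^3 * \<alpha>III) *\<^sub>R (outer d3l d3l + outer d3r d3r))"
    and "\<tau> = 1 / (4 * \<alpha>III) * (a1 + a2)"
    and "\<sigma> = 1 / (4 * \<alpha>II) * (a1 + a2)"
  shows "stable_up_to_outer_boundary a1 a2 b1 b2 H d1l d2l d3l d1r d2r d3r
           (\<lambda>w wtt. kron (diag2 b1 b2) (mat 1 :: 'm mat1) *v wtt =
              - (kron (diag2 a1 a2) D4 *v w)
              + sat1 \<tau> h a1 a2 H d3l d3r *v w
              + sat2 \<sigma> h a1 a2 H d1l d2l d1r d2r *v w
              + sat3 a1 a2 H d1l d2l d1r d2r *v w
              + sat4 a1 a2 H d3l d3r *v w)"
proof -
  note sbp = \<open>sbp4 p h H N d1l d2l d3l d1r d2r d3r D4\<close>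
  have H: "transpose H = H" and N: "transpose N = N"
    using sbp by (simp_all add: sbp4_def pos_def_def pos_semidef_def)
  have "pos_def H"
    using sbp by (simp add: sbp4_def)
  then have HHinv: "H *v (matrix_inv H *v x) = x" for x
    by (simp add: matrix_vector_mul_assoc pos_def_mult_matrix_inv)
  have D4: "D4 = matrix_inv H **
      (N + outer e_l d3l + outer d1l d2l + outer e_r d3r - outer d1r d2r)"
    using sbp by (simp add: sbp4_def)
  let ?M = "interface_matrix \<tau> \<sigma> h a1 a2 N d1l d2l d3l d1r d2r d3r"
  let ?Sys = "\<lambda>w wtt. kron (diag2 b1 b2) (mat 1 :: 'm mat1) *v wtt =
              - (kron (diag2 a1 a2) D4 *v w)
              + sat1 \<tau> h a1 a2 H d3l d3r *v w
              + sat2 \<sigma> h a1 a2 H d1l d2l d1r d2r *v w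
              + sat3 a1 a2 H d1l d2l d1r d2r *v w
              + sat4 a1 a2 H d3l d3r *v w"
  let ?BT = "outer_boundary_terms a1 a2 d1l d2l d3l d1r d2r d3r"
  \<comment> \<open>A purely algebraic identity at one instant: \<open>y\<close> is arbitrary and
    becomes the velocity only at the end.\<close>
  have rate: "2 * b1 * (block 1 z \<bullet> (H *v block 1 y)) + 2 * b2 * (block 2 z \<bullet> (H *v block 2 y))
      + 2 * (y \<bullet> (?M *v x)) = ?BT x y" if "?Sys x z" for x y z
  proof -
    define x1 x2 y1 y2 where "x1 = block 1 x" and "x2 = block 2 x"
      and "y1 = block 1 y" and "y2 = block 2 y"
    note defs = x1_def[symmetric] x2_def[symmetric] y1_def[symmetric] y2_def[symmetric]
    have eq: "H *v block b (kron (diag2 b1 b2) (mat 1) *v z) =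
        H *v block b (- (kron (diag2 a1 a2) D4 *v x)
              + sat1 \<tau> h a1 a2 H d3l d3r *v x
              + sat2 \<sigma> h a1 a2 H d1l d2l d1r d2r *v x
              + sat3 a1 a2 H d1l d2l d1r d2r *v x
              + sat4 a1 a2 H d3l d3r *v x)" for b
      using that by simp
    note simps = block_linear_simps block_kron_diag2 block_blocks2 sat1_def sat2_def sat3_def
      sat4_def D4 matrix_vector_mult_minus_left matrix_vector_mult_add_rdistrib
      matrix_vector_mult_diff_rdistrib scaleR_matrix_vector_assoc[symmetric]
      matrix_vector_mul_assoc[symmetric] outer_mult_vec defs
      matrix_vector_right_distrib matrix_vector_mult_diff_distrib matrix_vector_mult_scaleR
      linear_neg[OF matrix_vector_mul_linear] HHinv
    \<comment> \<open>\<open>SAT1\<close> and \<open>SAT2\<close> are proportional to the jumps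
      \<open>J\<close> and \<open>K\<close>. The last two terms, from \<open>SAT4\<close> and
      \<open>SAT3\<close>, carry half the jumps of a u_xx and a u_xxx, which turn the one-sided
      interface values coming from \<open>D4\<close> into averages.\<close>
    have e1: "b1 *\<^sub>R (H *v block 1 z) =
        - (a1 *\<^sub>R (N *v x1 + (d3l \<bullet> x1) *\<^sub>R e_l + (d2l \<bullet> x1) *\<^sub>R d1l
                  + (d3r \<bullet> x1) *\<^sub>R e_r - (d2r \<bullet> x1) *\<^sub>R d1r))
        - (e_r \<bullet> x1 - e_l \<bullet> x2) *\<^sub>R ((\<tau> / h^3) *\<^sub>R e_r + (a1 / 2) *\<^sub>R d3r)
        - (d1r \<bullet> x1 + d1l \<bullet> x2) *\<^sub>R ((\<sigma> / h) *\<^sub>R d1r - (a1 / 2) *\<^sub>R d2r)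
        - ((a1 * (d2r \<bullet> x1) + a2 * (d2l \<bullet> x2)) / 2) *\<^sub>R d1r
        + ((a1 * (d3r \<bullet> x1) + a2 * (d3l \<bullet> x2)) / 2) *\<^sub>R e_r"
      using eq[of 1] by (simp add: simps) (simp add: algebra_simps add_divide_distrib diff_divide_distrib)
    have e2: "b2 *\<^sub>R (H *v block 2 z) =
        - (a2 *\<^sub>R (N *v x2 + (d3l \<bullet> x2) *\<^sub>R e_l + (d2l \<bullet> x2) *\<^sub>R d1l
                  + (d3r \<bullet> x2) *\<^sub>R e_r - (d2r \<bullet> x2) *\<^sub>R d1r))
        + (e_r \<bullet> x1 - e_l \<bullet> x2) *\<^sub>R ((\<tau> / h^3) *\<^sub>R e_l + (a2 / 2) *\<^sub>R d3l)
        - (d1r \<bullet> x1 + d1l \<bullet> x2) *\<^sub>R ((\<sigma> / h) *\<^sub>R d1l + (a2 / 2) *\<^sub>R d2l)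
        + ((a1 * (d2r \<bullet> x1) + a2 * (d2l \<bullet> x2)) / 2) *\<^sub>R d1l
        + ((a1 * (d3r \<bullet> x1) + a2 * (d3l \<bullet> x2)) / 2) *\<^sub>R e_l"
      using eq[of 2] by (simp add: simps) (simp add: algebra_simps add_divide_distrib diff_divide_distrib)
    have sym: "u \<bullet> (H *v v) = v \<bullet> (H *v u)" for u v
      using H by (metis dot_lmul_matrix inner_commute vector_transpose_matrix)
    have "2 * b1 * (block 1 z \<bullet> (H *v y1)) + 2 * b2 * (block 2 z \<bullet> (H *v y2))
        = 2 * (y1 \<bullet> (b1 *\<^sub>R (H *v block 1 z))) + 2 * (y2 \<bullet> (b2 *\<^sub>R (H *v block 2 z)))"
      by (simp add: sym[of "block 1 z"] sym[of "block 2 z"])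
    \<comment> \<open>Paired with \<open>y\<close>, these averages give \<open>K y * Q x / 2\<close>
      and \<open>- J y * P x / 2\<close>; \<open>SAT1\<close> and \<open>SAT2\<close> supply the
      mirrored products, so the interface part is symmetric and cancels against
      \<open>?M\<close>.\<close>
    then show ?thesis
      unfolding inner_interface_matrix outer_boundary_terms_def defs e1 e2
      by (simp add: inner_simps inner_commute[of y1 e_l] inner_commute[of y1 e_r]
          inner_commute[of y1 d1l] inner_commute[of y1 d2l] inner_commute[of y1 d3l]
          inner_commute[of y1 d1r] inner_commute[of y1 d2r] inner_commute[of y1 d3r]
          inner_commute[of y2 e_l] inner_commute[of y2 e_r]
          inner_commute[of y2 d1l] inner_commute[of y2 d2l] inner_commute[of y2 d3l]
          inner_commute[of y2 d1r] inner_commute[of y2 d2r] inner_commute[of y2 d3r])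
        (simp add: algebra_simps add_divide_distrib diff_divide_distrib)
  qed
  have "pos_semidef ?M"
    by (rule pos_semidef_interface_matrix) (use assms N in auto)
  moreover have "\<exists>E'. ((\<lambda>s. energy b1 b2 H ?M (w s) (wt s)) has_real_derivative E') (at t within T)
      \<and> E' \<le> ?BT (w t) (wt t)"
    if sol: "solution_on ?Sys T w wt wtt" and t: "t \<in> T" for T w wt wtt t
  proof -
    have w: "(w has_vector_derivative wt t) (at t within T)"
      and wt: "(wt has_vector_derivative wtt t) (at t within T)"
      and sys: "?Sys (w t) (wtt t)"
      using sol t by (simp_all add: solution_on_def)
    note block = bounded_linear.has_vector_derivative[OF bounded_linear_block wt]
    have "((\<lambda>s. energy b1 b2 H ?M (w s) (wt s)) has_real_derivative
        b1 * (2 * (block 1 (wtt t) \<bullet> (H *v block 1 (wt t))))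
        + b2 * (2 * (block 2 (wtt t) \<bullet> (H *v block 2 (wt t))))
        + 2 * (wt t \<bullet> (?M *v w t))) (at t within T)"
      unfolding energy_def norm2_H_def
      by (intro DERIV_add DERIV_cmult has_real_derivative_quadratic_form block w H
          transpose_interface_matrix N)
    \<comment> \<open>With \<open>y\<close> the velocity, the derivative equals the outer boundary
      terms, so the bound holds with equality.\<close>
    with rate[OF sys, of "wt t"] show ?thesis
      by (intro exI conjI) (assumption, simp add: mult_ac)
  qed
  ultimately show ?thesis
    unfolding stable_up_to_outer_boundary_def by blast
qed

end
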